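(* Let $P$ be a self-dual word over $\{+,-,*\}$ of length at least $3$ that contains at least two occurrences of $*$. Then the cycle $\mathbb{G}=C(P\,+)$ is Słupecki.
   Context: All digraphs are reflexive. A $k$-ary polymorphism of a digraph $\mathbb{G}$ is a homomorphism (arc-preserving map) $\mathbb{G}^k\to\mathbb{G}$, where $\mathbb{G}^k$ is the usual (coordinatewise) power; it is essentially unary if there exist $1\le i\le k$ and a homomorphism $g:\mathbb{G}\to\mathbb{G}$ with $f(x_1,\dots,x_k)=g(x_i)$ for all $x_1,\dots,x_k$. $\mathbb{G}$ is Słupecki if all its surjective polymorphisms (of all arities $k\ge 1$) are essentially unary. For a word $W=x_1\cdots x_k$ over $\{+,-,*\}$, $\overline{W}=\overline{x_k}\cdots\overline{x_1}$ with $\overline{+}=-$, $\overline{-}=+$, $\overline{*}=*$; $W$ is self-dual if $W=\overline{W}$. For $k\ge 3$, $C(W)$ is the reflexive digraph with vertex set $\{0,\dots,k-1\}$ (indices mod $k$) in which, for $1\le i\le k$, between $i-1$ and $i$ there is exactly the arc $(i-1,i)$ if $x_i=+$, exactly the arc $(i,i-1)$ if $x_i=-$, and both arcs if $x_i=*$, and there are no other arcs besides loops. $P\,+$ denotes the word $P$ followed by the letter $+$. *)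

theory Defs
  imports "Graph_Theory.Pair_Digraph" "HOL-Library.FuncSet"
begin

section \<open>Homomorphisms, powers and polymorphisms of digraphs\<close>

definition digraph_hom ::
  "'a pair_pre_digraph \<Rightarrow> 'b pair_pre_digraph \<Rightarrow> ('a \<Rightarrow> 'b) \<Rightarrow> bool" where
  "digraph_hom G H f \<longleftrightarrow>
     f \<in> pverts G \<rightarrow> pverts H \<and>
     (\<forall>(u, v) \<in> parcs G. (f u, f v) \<in> parcs H)"

text \<open>
  A \<open>k\<close>-tuple \<open>(x\<^sub>1, \<dots>, x\<^sub>k)\<close> is the function \<open>x\<close> on \<open>{1..k}\<close>, extended by
  \<open>undefined\<close> outside \<open>{1..k}\<close>, so that each tuple has a unique representation.
\<close>
definition digraph_power :: "'a pair_pre_digraph \<Rightarrow> nat \<Rightarrow> (nat \<Rightarrow> 'a) pair_pre_digraph" where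
  "digraph_power G k =
     \<lparr> pverts = ({1..k} \<rightarrow>\<^sub>E pverts G),
       parcs = {(x, y). x \<in> ({1..k} \<rightarrow>\<^sub>E pverts G) \<and> y \<in> ({1..k} \<rightarrow>\<^sub>E pverts G) \<and>
                        (\<forall>i \<in> {1..k}. (x i, y i) \<in> parcs G)} \<rparr>"

definition polymorphism :: "'a pair_pre_digraph \<Rightarrow> nat \<Rightarrow> ((nat \<Rightarrow> 'a) \<Rightarrow> 'a) \<Rightarrow> bool" where
  "polymorphism G k f \<longleftrightarrow> digraph_hom (digraph_power G k) G f"

definition essentially_unary :: "'a pair_pre_digraph \<Rightarrow> nat \<Rightarrow> ((nat \<Rightarrow> 'a) \<Rightarrow> 'a) \<Rightarrow> bool" where
  "essentially_unary G k f \<longleftrightarrow>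
     (\<exists>i \<in> {1..k}. \<exists>g. digraph_hom G G g \<and>
        (\<forall>x \<in> pverts (digraph_power G k). f x = g (x i)))"

definition slupecki :: "'a pair_pre_digraph \<Rightarrow> bool" where
  "slupecki G \<longleftrightarrow>
     (\<forall>k \<ge> 1. \<forall>f. polymorphism G k f \<and> f ` pverts (digraph_power G k) = pverts G
        \<longrightarrow> essentially_unary G k f)"


section \<open>Words and the cycles they encode\<close>

datatype letter = Plus | Minus | Star

fun letter_dual :: "letter \<Rightarrow> letter" where
  "letter_dual Plus = Minus"
| "letter_dual Minus = Plus"
| "letter_dual Star = Star"

definition word_dual :: "letter list \<Rightarrow> letter list" where
  "word_dual W = rev (map letter_dual W)"

definition self_dual :: "letter list \<Rightarrow> bool" where
  "self_dual W \<longleftrightarrow> W = word_dual W"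

text \<open>
  The letter \<open>x\<^sub>i\<close> of \<open>W = x\<^sub>1 \<dots> x\<^sub>k\<close> is \<open>W ! (i - 1)\<close>, and vertex \<open>k\<close> is identified with
  vertex \<open>0\<close>. The definition is only meant for words of length at least 3; for shorter
  words the positions of \<open>W\<close> do not correspond to distinct pairs of distinct vertices.
\<close>
definition cycle_digraph :: "letter list \<Rightarrow> nat pair_pre_digraph" where
  "cycle_digraph W =
     (let k = length W in
      \<lparr> pverts = {0..<k},
        parcs = {(v, v) | v. v \<in> {0..<k}}
          \<union> {(i - 1, i mod k) | i. i \<in> {1..k} \<and> W ! (i - 1) \<in> {Plus, Star}}
          \<union> {(i mod k, i - 1) | i. i \<in> {1..k} \<and> W ! (i - 1) \<in> {Minus, Star}} \<rparr>)"

lemma cycle_digraph_finite_wf: "pair_fin_digraph (cycle_digraph W)"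
proof -
  have *: "parcs (cycle_digraph W) \<subseteq> pverts (cycle_digraph W) \<times> pverts (cycle_digraph W)"
    by (auto simp: cycle_digraph_def Let_def intro!: mod_less_divisor)
  moreover have "finite (pverts (cycle_digraph W))"
    by (simp add: cycle_digraph_def Let_def)
  ultimately show ?thesis
    by unfold_locales (auto intro: finite_subset)
qed

lemma cycle_digraph_reflexive: "v \<in> pverts (cycle_digraph W) \<Longrightarrow> (v, v) \<in> parcs (cycle_digraph W)"
  by (auto simp: cycle_digraph_def Let_def)

end

theory Submission
  imports Defs "HOL-Number_Theory.Cong"
begin

text \<open>
  The argument works for every reflexive cycle of girth \<open>n \<ge> 4\<close> with a two-way edge. View the
  cycle as the integers modulo \<open>n\<close> and let \<open>f\<close> be a polymorphism. Fixing all coordinates but one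
  gives a homomorphism from the cycle to itself, of degree \<open>- 1\<close>, \<open>0\<close> or \<open>1\<close>.

  If some degree is \<open>\<plusminus> 1\<close>, the homomorphism is a rotation or a reflection. It is then rigid: two
  of these that are joined by an arc differ at most by a shift by one, and such a shift would force
  all edges to be one-way. So it does not change when the other coordinates move, and \<open>f\<close> depends on
  one coordinate only.

  If all degrees are \<open>0\<close>, then \<open>f\<close> lifts to a map \<open>H\<close> into the universal cover of the cycle, and if
  \<open>f\<close> is onto, then \<open>H\<close> takes two values at distance at least \<open>n - 1\<close>. Let \<open>l\<close> be the least length
  for which the ends of a path of \<open>n - 1\<close> edges in the cover are joined by zigzag walks of length \<open>l\<close>
  of both types (starting forward and starting backward). Cutting off an end, any other two vertices
  of this path are joined by both types of length \<open>l - 1\<close>; in the cycle the two ends are joined as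
  well, through the remaining edge. Hence any two tuples are joined by both types of length \<open>l - 1\<close>,
  and applying \<open>H\<close> contradicts the minimality of \<open>l\<close>.
\<close>

section \<open>Zigzag walks\<close>

text \<open>The direction in which the arcs are traversed alternates, the first step being forward.\<close>

primrec zigzag :: "nat \<Rightarrow> ('a \<Rightarrow> 'a \<Rightarrow> bool) \<Rightarrow> 'a \<Rightarrow> 'a \<Rightarrow> bool" where
  "zigzag 0 r = (=)"
| "zigzag (Suc l) r = r OO zigzag l r\<inverse>\<inverse>"

text \<open>Reversing a walk keeps its type if \<open>l\<close> is even and swaps it if
  \<open>l\<close> is odd; a loop in front swaps it too. With both types demanded, the relation is
  symmetric and, for reflexive \<open>r\<close>, monotone in \<open>l\<close>.\<close>

definition zigzag_both :: "nat \<Rightarrow> ('a \<Rightarrow> 'a \<Rightarrow> bool) \<Rightarrow> 'a \<Rightarrow> 'a \<Rightarrow> bool" where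
  "zigzag_both l r a b \<longleftrightarrow> zigzag l r a b \<and> zigzag l r\<inverse>\<inverse> a b"

lemma zigzag_snoc:
  "zigzag (Suc l) r = zigzag l r OO (if even l then r else r\<inverse>\<inverse>)"
proof (induction l arbitrary: r)
  case (Suc l)
  have "zigzag (Suc (Suc l)) r = r OO zigzag (Suc l) r\<inverse>\<inverse>"
    by simp
  also have "\<dots> = (r OO zigzag l r\<inverse>\<inverse>) OO (if even l then r\<inverse>\<inverse> else r)"
    unfolding Suc.IH by (simp add: relcompp_assoc)
  finally show ?case
    by (cases "even l") (simp_all del: conversep_iff)
qed (auto simp: fun_eq_iff)

lemma conversep_zigzag:
  "(zigzag l r)\<inverse>\<inverse> = zigzag l (if even l then r else r\<inverse>\<inverse>)"
proof (induction l arbitrary: r)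
  case (Suc l)
  have "(zigzag (Suc l) r)\<inverse>\<inverse> = (zigzag l r\<inverse>\<inverse>)\<inverse>\<inverse> OO r\<inverse>\<inverse>"
    by (simp add: converse_relcompp)
  also have "\<dots> = zigzag l (if even l then r\<inverse>\<inverse> else r) OO r\<inverse>\<inverse>"
    unfolding Suc.IH by simp
  also have "\<dots> = zigzag (Suc l) (if even (Suc l) then r else r\<inverse>\<inverse>)"
    unfolding zigzag_snoc by simp
  finally show ?case .
qed (auto simp: fun_eq_iff)

lemma zigzag_both_sym: "zigzag_both l r a b \<Longrightarrow> zigzag_both l r b a"
  using fun_cong[OF fun_cong[OF conversep_zigzag[of l r]], of b a]
    fun_cong[OF fun_cong[OF conversep_zigzag[of l "r\<inverse>\<inverse>"]], of b a]
  by (auto simp: zigzag_both_def split: if_splits)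

lemma zigzag_refl: "reflp r \<Longrightarrow> zigzag l r a a"
proof (induction l arbitrary: r)
  case (Suc l)
  then have "r a a" "zigzag l r\<inverse>\<inverse> a a"
    by (auto simp: reflp_def)
  then show ?case
    by auto
qed simp

lemma zigzag_both_Suc: "reflp r \<Longrightarrow> zigzag_both l r a b \<Longrightarrow> zigzag_both (Suc l) r a b"
  by (auto simp: zigzag_both_def reflp_def intro!: relcomppI[of _ a a])

lemma zigzag_both_mono:
  assumes "reflp r" "l \<le> l'" "zigzag_both l r a b"
  shows "zigzag_both l' r a b"
  using assms(2) by (induction l' rule: dec_induct) (use assms in \<open>auto intro: zigzag_both_Suc\<close>)

lemma zigzag_both_2:
  assumes "reflp r" "r a b \<or> r b a"
  shows "zigzag_both 2 r a b"
  using assms unfolding zigzag_both_def numeral_2_eq_2 reflp_def by (auto simp: relcompp_apply)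

lemma zigzag_both_trans:
  assumes "zigzag_both 2 r a b" "zigzag_both l r b c"
  shows "zigzag_both (Suc (Suc l)) r a c"
  using assms unfolding zigzag_both_def numeral_2_eq_2 by (auto simp: relcompp_apply)

lemma zigzag_hom:
  assumes "\<And>a b. r a b \<Longrightarrow> s (h a) (h b)" "zigzag l r a b"
  shows "zigzag l s (h a) (h b)"
  using assms
proof (induction l arbitrary: r s a)
  case (Suc l)
  from Suc.prems(2) obtain c where c: "r a c" "zigzag l r\<inverse>\<inverse> c b"
    by auto
  have "zigzag l s\<inverse>\<inverse> (h c) (h b)"
    using Suc.prems(1) by (intro Suc.IH[OF _ c(2)]) auto
  with Suc.prems(1)[OF c(1)] show ?case
    by auto
qed simp

lemma zigzag_both_hom:
  assumes "\<And>a b. r a b \<Longrightarrow> s (h a) (h b)" "zigzag_both l r a b"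
  shows "zigzag_both l s (h a) (h b)"
  using assms zigzag_hom[of r s h l a b] zigzag_hom[of "r\<inverse>\<inverse>" "s\<inverse>\<inverse>" h l a b]
  by (auto simp: zigzag_both_def)

text \<open>Walks of equal length and type move in step, so they can be run in all coordinates at
  once.\<close>

lemma zigzag_power:
  assumes "\<And>i. zigzag l r (x i) (y i)"
  shows "zigzag l (\<lambda>x y. \<forall>i. r (x i) (y i)) x y"
  using assms
proof (induction l arbitrary: r x)
  case (Suc l)
  from Suc.prems have "\<forall>i. \<exists>c. r (x i) c \<and> zigzag l r\<inverse>\<inverse> c (y i)"
    by auto
  then obtain c where c: "\<And>i. r (x i) (c i)" "\<And>i. zigzag l r\<inverse>\<inverse> (c i) (y i)"
    by metis
  have eq: "(\<lambda>x y. \<forall>i. r (x i) (y i))\<inverse>\<inverse> = (\<lambda>x y. \<forall>i. r\<inverse>\<inverse> (x i) (y i))"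
    by (auto simp: fun_eq_iff)
  have "zigzag l (\<lambda>x y. \<forall>i. r (x i) (y i))\<inverse>\<inverse> c y"
    unfolding eq by (rule Suc.IH[OF c(2)])
  with c(1) show ?case
    unfolding zigzag.simps by (intro relcomppI[of _ x c] allI)
qed auto

lemma zigzag_both_power:
  assumes "\<And>i. zigzag_both l r (x i) (y i)"
  shows "zigzag_both l (\<lambda>x y. \<forall>i. r (x i) (y i)) x y"
proof -
  have eq: "(\<lambda>x y. \<forall>i. r (x i) (y i))\<inverse>\<inverse> = (\<lambda>x y. \<forall>i. r\<inverse>\<inverse> (x i) (y i))"
    by (auto simp: fun_eq_iff)
  show ?thesis
    unfolding zigzag_both_def eq using assms by (intro conjI zigzag_power) (simp_all only: zigzag_both_def)
qed

section \<open>Truncating walks on the integer line\<close>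

text \<open>Steps have size at most 1, so the walk meets \<open>b\<close> after at most
  \<open>l\<close> steps; it stops there and the remaining steps are loops.\<close>

lemma zigzag_truncate:
  fixes a b c :: int
  assumes "\<And>a b. r a b \<Longrightarrow> \<bar>a - b\<bar> \<le> 1" "reflp r" "zigzag (Suc l) r a c" "a \<le> b" "b < c"
  shows "zigzag l r a b"
  using assms
proof (induction l arbitrary: r a)
  case 0
  then show ?case
    by force
next
  case (Suc l)
  show ?case
  proof (cases "a = b")
    case True
    with zigzag_refl[OF Suc.prems(2), of "Suc l"] show ?thesis
      by (simp only:)
  next
    case False
    from Suc.prems(3) obtain a' where a': "r a a'" "zigzag (Suc l) r\<inverse>\<inverse> a' c"
      by (auto simp del: zigzag.simps(2) simp: zigzag.simps(2)[of "Suc l"])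
    have "zigzag l r\<inverse>\<inverse> a' b"
    proof (rule Suc.IH[OF _ _ a'(2)])
      show "\<bar>a - b\<bar> \<le> 1" if "r\<inverse>\<inverse> a b" for a b
        using Suc.prems(1)[of b a] that by auto
      show "a' \<le> b"
        using Suc.prems(1)[OF a'(1)] Suc.prems(4) False by linarith
    qed (use Suc.prems in \<open>auto simp: reflp_def\<close>)
    with a' show ?thesis
      by auto
  qed
qed

lemma zigzag_both_truncate:
  fixes a b c :: int
  assumes "\<And>a b. r a b \<Longrightarrow> \<bar>a - b\<bar> \<le> 1" "reflp r" "zigzag_both (Suc l) r a c" "a \<le> b" "b < c"
  shows "zigzag_both l r a b"
proof -
  have "\<bar>a - b\<bar> \<le> 1" if "r\<inverse>\<inverse> a b" for a b
    using assms(1)[of b a] that by auto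
  with zigzag_truncate[of r l a c b] zigzag_truncate[of "r\<inverse>\<inverse>" l a c b] assms show ?thesis
    by (auto simp: zigzag_both_def reflp_def)
qed

lemma zigzag_both_truncate_left:
  fixes a b c :: int
  assumes "\<And>a b. r a b \<Longrightarrow> \<bar>a - b\<bar> \<le> 1" "reflp r" "zigzag_both (Suc l) r a c" "a < b" "b \<le> c"
  shows "zigzag_both l r b c"
proof -
  \<comment> \<open>Reflecting the line and reversing the walk exchanges its ends, so the previous
    truncation applies.\<close>
  define s where "s = (\<lambda>a b. r (- a) (- b))"
  have "zigzag_both (Suc l) s (- c) (- a)"
    by (rule zigzag_both_hom[of r _ uminus, OF _ zigzag_both_sym[OF assms(3)]]) (simp add: s_def)
  moreover have "\<bar>a - b\<bar> \<le> 1" if "s a b" for a b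
    using assms(1)[of "-a" "-b"] that by (auto simp: s_def)
  moreover have "reflp s"
    using assms(2) by (auto simp: s_def reflp_def)
  ultimately have "zigzag_both l s (- c) (- b)"
    using assms(4,5) by (intro zigzag_both_truncate[of s l "- c" "- a" "- b"]) auto
  then have "zigzag_both l r (- (- c)) (- (- b))"
    by (rule zigzag_both_hom[of s r uminus, rotated]) (simp add: s_def)
  then show ?thesis
    by (simp add: zigzag_both_sym)
qed

lemma zigzag_length:
  fixes a b :: int
  assumes "\<And>a b. r a b \<Longrightarrow> \<bar>a - b\<bar> \<le> 1" "zigzag l r a b"
  shows "\<bar>a - b\<bar> \<le> int l"
  using assms
proof (induction l arbitrary: r a)
  case (Suc l)
  from Suc.prems(2) obtain a' where a': "r a a'" "zigzag l r\<inverse>\<inverse> a' b"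
    by auto
  have "\<bar>a' - b\<bar> \<le> int l"
  proof (rule Suc.IH[OF _ a'(2)])
    show "\<bar>a - b\<bar> \<le> 1" if "r\<inverse>\<inverse> a b" for a b
      using Suc.prems(1)[of b a] that by auto
  qed
  with Suc.prems(1)[OF a'(1)] show ?case
    by simp
qed simp


section \<open>Reflexive cycles on the integers modulo \<open>n\<close>\<close>

text \<open>
  \<open>R\<close> is the arc relation pulled back along reduction modulo \<open>n\<close>, so that no vertex needs to be
  normalised; an arc of the universal cover is \<open>R a b\<close> together with \<open>\<bar>a - b\<bar> \<le> 1\<close>.
\<close>

locale star_cycle =
  fixes n :: int and R :: "int \<Rightarrow> int \<Rightarrow> bool"
  assumes n_ge_4: "4 \<le> n"
    and R_cong: "[a = a'] (mod n) \<Longrightarrow> [b = b'] (mod n) \<Longrightarrow> R a b \<Longrightarrow> R a' b'"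
    and R_refl: "R a a"
    and R_near: "R a b \<Longrightarrow> \<exists>d. \<bar>d\<bar> \<le> 1 \<and> [b = a + d] (mod n)"
    and R_edge: "R a (a + 1) \<or> R (a + 1) a"
    and R_star: "\<exists>s. R s (s + 1) \<and> R (s + 1) s"
begin

lemma cong_small_eq: "[a = b] (mod n) \<Longrightarrow> \<bar>a - b\<bar> < n \<Longrightarrow> a = b"
  using dvd_imp_le_int[of "a - b" n] n_ge_4 by (force simp: cong_iff_dvd_diff)

text \<open>Here girth at least 4 enters: \<open>b - a\<close> and the \<open>d\<close> given by
  \<open>R_near\<close> are congruent and differ by at most 3, hence are equal. So integers two
  apart are never joined.\<close>

lemma R_close:
  assumes "R a b" "\<bar>a - b\<bar> \<le> 2"
  shows "\<bar>a - b\<bar> \<le> 1"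
proof -
  obtain d where d: "\<bar>d\<bar> \<le> 1" "[b = a + d] (mod n)"
    using R_near assms(1) by blast
  then have "b = a + d"
    using assms(2) n_ge_4 by (intro cong_small_eq) auto
  with d show ?thesis
    by simp
qed

lemma R_all_cong: "[a = b] (mod n) \<Longrightarrow> R a b"
  using R_cong[OF cong_refl _ R_refl] by blast

text \<open>Reversing all arcs and, below, reflecting the cycle preserve the locale, so rigidity is
  proved for one orientation and carried over.\<close>

lemma star_cycle_conversep: "star_cycle n R\<inverse>\<inverse>"
proof
  show "\<exists>d. \<bar>d\<bar> \<le> 1 \<and> [b = a + d] (mod n)" if ab: "R\<inverse>\<inverse> a b" for a b
  proof -
    obtain d where d: "\<bar>d\<bar> \<le> 1" "[a = b + d] (mod n)"
      using R_near[of b a] ab by auto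
    then have "[b = a + (- d)] (mod n)"
      using cong_add[OF cong_sym[OF d(2)] cong_refl[of "- d"]] by simp
    with d(1) show ?thesis
      by (intro exI[of _ "- d"]) simp
  qed
  show "R\<inverse>\<inverse> a (a + 1) \<or> R\<inverse>\<inverse> (a + 1) a" for a
    using R_edge[of a] by auto
qed (use n_ge_4 R_cong R_refl R_star in auto)

lemma star_cycle_uminus: "star_cycle n (\<lambda>a b. R (- a) (- b))"
proof
  show "\<exists>d. \<bar>d\<bar> \<le> 1 \<and> [b = a + d] (mod n)" if ab: "R (- a) (- b)" for a b
  proof -
    obtain d where d: "\<bar>d\<bar> \<le> 1" "[- b = - a + d] (mod n)"
      using R_near[OF ab] by auto
    then have "[b = a + (- d)] (mod n)"
      using cong_minus_minus_iff[of "- b" "- a + d" n] by simp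
    with d(1) show ?thesis
      by (intro exI[of _ "- d"]) simp
  qed
  show "R (- a) (- (a + 1)) \<or> R (- (a + 1)) (- a)" for a
    using R_edge[of "- a - 1"] by (simp add: disj_commute)
  obtain s where "R s (s + 1)" "R (s + 1) s"
    using R_star by blast
  then show "\<exists>s. R (- s) (- (s + 1)) \<and> R (- (s + 1)) (- s)"
    by (intro exI[of _ "- s - 1"]) (simp add: add.commute)
  show "R (- a') (- b')" if "[a = a'] (mod n)" "[b = b'] (mod n)" "R (- a) (- b)" for a a' b b'
    using that by (intro R_cong[OF _ _ that(3)]) (simp_all add: cong_minus_minus_iff)
qed (use n_ge_4 R_refl in auto)

section \<open>Rigidity of rotations and reflections\<close>

text \<open>If \<open>\<psi>\<close> were shifted by \<open>e\<close> against the rotation or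
  reflection \<open>\<phi>\<close> at \<open>w\<close>, an arc from \<open>w - 1\<close> to
  \<open>w\<close> would yield one from \<open>\<phi> w - e\<close> to \<open>\<phi> w + e\<close>,
  which are two apart. So this edge is one-way, the shift passes on to \<open>w - 1\<close>, and it
  runs around the cycle until it meets the two-way edge.\<close>

lemma rigid_shift:
  fixes \<phi> \<psi> :: "int \<Rightarrow> int"
  assumes \<phi>: "\<And>t. [\<phi> (t + 1) = \<phi> t + e] (mod n)" and e: "e = 1 \<or> e = - 1"
    and \<phi>\<psi>: "\<And>a b. R a b \<Longrightarrow> R (\<phi> a) (\<psi> b)" and \<psi>: "\<And>a b. R a b \<Longrightarrow> R (\<psi> a) (\<psi> b)"
  shows "\<not> [\<psi> v = \<phi> v + e] (mod n)"
proof
  assume v: "[\<psi> v = \<phi> v + e] (mod n)"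
  have down: "\<not> R (w - 1) w \<and> [\<psi> (w - 1) = \<phi> (w - 1) + e] (mod n)"
    if w: "[\<psi> w = \<phi> w + e] (mod n)" for w
  proof -
    have \<phi>1: "[\<phi> (w - 1) = \<phi> w - e] (mod n)"
      using cong_diff[OF cong_sym[OF \<phi>[of "w - 1"]] cong_refl[of e]] by simp
    have not_up: "\<not> R (w - 1) w"
    proof
      assume "R (w - 1) w"
      from R_cong[OF \<phi>1 w \<phi>\<psi>[OF this]] R_close[of "\<phi> w - e" "\<phi> w + e"] e show False
        by auto
    qed
    then have dn: "R w (w - 1)"
      using R_edge[of "w - 1"] by simp
    obtain d where d: "\<bar>d\<bar> \<le> 1" "[\<psi> (w - 1) = \<phi> (w - 1) + d] (mod n)"
      using R_near[OF \<phi>\<psi>[OF R_refl]] by blast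
    \<comment> \<open>\<open>q\<close> represents \<open>\<psi> (w - 1)\<close> and is within 1 of
      \<open>\<phi> w - e\<close>. The arc from \<open>w\<close> to \<open>w - 1\<close> puts it
      within 1 of \<open>\<phi> w\<close> and then of \<open>\<phi> w + e\<close>, so it equals
      \<open>\<phi> w\<close>.\<close>
    define q where "q = \<phi> w - e + d"
    have q: "[\<psi> (w - 1) = q] (mod n)"
      unfolding q_def using cong_trans[OF d(2) cong_add[OF \<phi>1 cong_refl]] .
    have 1: "R (\<phi> w) q"
      using R_cong[OF cong_refl q \<phi>\<psi>[OF dn]] .
    have 2: "R (\<phi> w + e) q"
      using R_cong[OF w q \<psi>[OF dn]] .
    have "\<bar>\<phi> w - q\<bar> \<le> 2"
      using d(1) e by (auto simp: q_def)
    then have 3: "\<bar>\<phi> w - q\<bar> \<le> 1"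
      using R_close[OF 1] by blast
    then have "\<bar>\<phi> w + e - q\<bar> \<le> 1"
      using R_close[OF 2] e by auto
    then have "q = \<phi> w"
      using 3 d(1) e by (auto simp: q_def)
    then have "[\<psi> (w - 1) = \<phi> (w - 1) + e] (mod n)"
      using cong_trans[OF q] cong_add[OF cong_sym[OF \<phi>1] cong_refl[of e]] by simp
    with not_up show ?thesis
      by blast
  qed
  have all: "[\<psi> (v - int k) = \<phi> (v - int k) + e] (mod n)" for k
  proof (induction k)
    case (Suc k)
    then show ?case
      using down[OF Suc] by (simp add: algebra_simps)
  qed (use v in simp)
  obtain s where s: "R s (s + 1)"
    using R_star by blast
  \<comment> \<open>Going down \<open>k\<close> steps from \<open>v\<close> reaches
    \<open>s + 1\<close> modulo \<open>n\<close>, the head of a forward arc.\<close>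
  define k where "k = nat ((v - (s + 1)) mod n)"
  have k: "int k = (v - (s + 1)) mod n"
    unfolding k_def using n_ge_4 by simp
  then have "[int k = v - (s + 1)] (mod n)"
    by (simp add: cong_def)
  then have "[v - int k = s + 1] (mod n)"
    using cong_diff[OF cong_refl[of v], of "int k" "v - (s + 1)" n] by simp
  then have "R (v - int k - 1) (v - int k)"
    using cong_diff[OF _ cong_refl[of 1], of "v - int k" "s + 1" n]
    by (intro R_cong[OF _ _ s] cong_sym[of "v - int k - 1"] cong_sym[of "v - int k"]) simp_all
  with down[OF all[of k]] show False
    by blast
qed

lemma rigid_forward:
  fixes \<phi> \<psi> :: "int \<Rightarrow> int"
  assumes \<phi>: "\<And>t. [\<phi> (t + 1) = \<phi> t + e] (mod n)" and e: "e = 1 \<or> e = - 1"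
    and \<phi>\<psi>: "\<And>a b. R a b \<Longrightarrow> R (\<phi> a) (\<psi> b)" and \<psi>: "\<And>a b. R a b \<Longrightarrow> R (\<psi> a) (\<psi> b)"
  shows "[\<psi> v = \<phi> v] (mod n)"
proof -
  obtain d where d: "\<bar>d\<bar> \<le> 1" "[\<psi> v = \<phi> v + d] (mod n)"
    using R_near[OF \<phi>\<psi>[OF R_refl]] by blast
  have "d \<noteq> e"
    using rigid_shift[where \<phi> = \<phi> and \<psi> = \<psi>, OF \<phi> e \<phi>\<psi> \<psi>, of v] d(2) by auto
  moreover have "d \<noteq> - e"
  proof -
    \<comment> \<open>Conjugating with negation keeps the slope \<open>e\<close> of
      \<open>\<phi>\<close> and turns a shift by \<open>- e\<close> into one by
      \<open>e\<close>.\<close>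
    interpret mirror: star_cycle n "\<lambda>a b. R (- a) (- b)"
      by (rule star_cycle_uminus)
    have "\<not> [- \<psi> (- (- v)) = - \<phi> (- (- v)) + e] (mod n)"
    proof (rule mirror.rigid_shift[where \<phi> = "\<lambda>t. - \<phi> (- t)" and \<psi> = "\<lambda>t. - \<psi> (- t)", OF _ e])
      show "[- \<phi> (- (t + 1)) = - \<phi> (- t) + e] (mod n)" for t
        using \<phi>[of "- (t + 1)"] by (simp add: cong_iff_dvd_diff algebra_simps)
    qed (use \<phi>\<psi> \<psi> in auto)
    moreover have "[- \<psi> v = - \<phi> v + (- d)] (mod n)"
      using d(2) cong_minus_minus_iff[of "\<psi> v" "\<phi> v + d" n] by simp
    ultimately show ?thesis
      by auto
  qed
  ultimately have "d = 0"
    using d(1) e by auto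
  with d(2) show ?thesis
    by simp
qed

lemma rigid:
  fixes \<phi> \<psi> :: "int \<Rightarrow> int"
  assumes \<phi>: "\<And>t. [\<phi> (t + 1) = \<phi> t + e] (mod n)" and e: "e = 1 \<or> e = - 1"
    and \<psi>_hom: "\<And>a b. R a b \<Longrightarrow> R (\<psi> a) (\<psi> b)"
    and "(\<forall>a b. R a b \<longrightarrow> R (\<phi> a) (\<psi> b)) \<or> (\<forall>a b. R a b \<longrightarrow> R (\<psi> a) (\<phi> b))"
  shows "[\<psi> v = \<phi> v] (mod n)"
  using assms(4)
proof
  assume "\<forall>a b. R a b \<longrightarrow> R (\<phi> a) (\<psi> b)"
  then show ?thesis
    by (intro rigid_forward[where \<phi> = \<phi> and \<psi> = \<psi>, OF \<phi> e]) (use \<psi>_hom in auto)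
next
  assume *: "\<forall>a b. R a b \<longrightarrow> R (\<psi> a) (\<phi> b)"
  interpret dual: star_cycle n "R\<inverse>\<inverse>"
    by (rule star_cycle_conversep)
  show ?thesis
    by (rule dual.rigid_forward[where \<phi> = \<phi> and \<psi> = \<psi>, OF \<phi> e]) (use * \<psi>_hom in auto)
qed

end


section \<open>Polymorphisms of reflexive cycles\<close>

text \<open>Arguments are integer-valued functions on all of \<open>nat\<close>;
  \<open>F_cong\<close> makes the residue of \<open>F\<close> depend only on the residues on
  \<open>I\<close>, so coordinates can be updated freely.\<close>

locale star_cycle_polymorphism = star_cycle +
  fixes I :: "nat set" and F :: "(nat \<Rightarrow> int) \<Rightarrow> int"
  assumes finite_I: "finite I"
    and F_hom: "(\<And>i. i \<in> I \<Longrightarrow> R (x i) (y i)) \<Longrightarrow> R (F x) (F y)"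
    and F_cong: "(\<And>i. i \<in> I \<Longrightarrow> [x i = y i] (mod n)) \<Longrightarrow> [F x = F y] (mod n)"
begin

section \<open>Coordinates of degree 1 or -1\<close>

text \<open>For \<open>e = 1\<close> a rotation and for \<open>e = - 1\<close> a reflection of the
  cycle, in coordinate \<open>j\<close> alone.\<close>

definition winds :: "nat \<Rightarrow> (nat \<Rightarrow> int) \<Rightarrow> int \<Rightarrow> bool" where
  "winds j x e \<longleftrightarrow> (\<forall>t. [F (x(j := t + 1)) = F (x(j := t)) + e] (mod n))"

text \<open>Coordinate \<open>i\<close> travels from \<open>x i\<close> to \<open>a\<close> one edge
  at a time, and by \<open>rigid\<close> no edge changes the map in coordinate
  \<open>j\<close>.\<close>

lemma winds_move:
  assumes "winds j x e" "e = 1 \<or> e = - 1" "i \<noteq> j"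
  shows "winds j (x(i := a)) e \<and> (\<forall>t. [F ((x(i := a))(j := t)) = F (x(j := t))] (mod n))"
proof -
  have step: "winds j (x(i := b)) e \<and> (\<forall>t. [F ((x(i := b))(j := t)) = F ((x(i := a))(j := t))] (mod n))"
    if "winds j (x(i := a)) e" "R a b \<or> R b a" for a b
  proof -
    have eq: "[F ((x(i := b))(j := t)) = F ((x(i := a))(j := t))] (mod n)" for t
    proof (rule rigid[where \<phi> = "\<lambda>t. F ((x(i := a))(j := t))" and \<psi> = "\<lambda>t. F ((x(i := b))(j := t))"])
      show "[F ((x(i := a))(j := t + 1)) = F ((x(i := a))(j := t)) + e] (mod n)" for t
        using that(1) by (auto simp: winds_def)
      show "(\<forall>s t. R s t \<longrightarrow> R (F ((x(i := a))(j := s))) (F ((x(i := b))(j := t)))) \<or>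
          (\<forall>s t. R s t \<longrightarrow> R (F ((x(i := b))(j := s))) (F ((x(i := a))(j := t))))"
        using that(2)
      proof
        assume "R a b"
        then show ?thesis
          by (intro disjI1 allI impI F_hom) (auto simp: R_refl)
      next
        assume "R b a"
        then show ?thesis
          by (intro disjI2 allI impI F_hom) (auto simp: R_refl)
      qed
    qed (use assms(2) in \<open>auto intro!: F_hom simp: R_refl\<close>)
    have "[F ((x(i := b))(j := t + 1)) = F ((x(i := b))(j := t)) + e] (mod n)" for t
      using eq[of "t + 1"] eq[of t] that(1)
      by (meson cong_add cong_refl cong_sym cong_trans winds_def)
    with eq show ?thesis
      by (auto simp: winds_def)
  qed
  show ?thesis
  proof (induction a rule: int_induct[where k = "x i"])
    case base
    with assms(1) show ?case
      by simp
  next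
    case (step1 a)
    with step[of a "a + 1"] R_edge[of a] show ?case
      by (meson cong_trans)
  next
    case (step2 a)
    with step[of a "a - 1"] R_edge[of "a - 1"] show ?case
      by (metis cong_trans diff_add_cancel)
  qed
qed

text \<open>The coordinates of \<open>I\<close> other than \<open>j\<close> are changed from
  \<open>x\<close> to \<open>y\<close> one by one.\<close>

lemma winds_unary:
  assumes "winds j x e" "e = 1 \<or> e = - 1" "j \<in> I"
  shows "[F y = F (x(j := y j))] (mod n)"
proof -
  have "finite (I - {j})"
    using finite_I by simp
  then have "winds j (override_on x y (I - {j})) e \<and>
      (\<forall>t. [F ((override_on x y (I - {j}))(j := t)) = F (x(j := t))] (mod n))"
    (is "?P (I - {j})")
  proof (rule finite_subset_induct[OF _ subset_refl])
    show "?P {}"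
      using assms(1) by simp
  next
    fix i J
    assume i: "i \<in> I - {j}" and IH: "?P J"
    have eq: "override_on x y (insert i J) = (override_on x y J)(i := y i)"
      by (auto simp: override_on_def)
    show "?P (insert i J)"
      unfolding eq using winds_move[OF conjunct1[OF IH] assms(2), of i "y i"] i IH
      by (blast intro: cong_trans)
  qed
  moreover have "[F y = F ((override_on x y (I - {j}))(j := y j))] (mod n)"
    by (rule F_cong) (auto simp: override_on_def)
  ultimately show ?thesis
    using cong_trans by blast
qed

section \<open>Lifting to the universal cover\<close>

definition restrict0 :: "nat set \<Rightarrow> (nat \<Rightarrow> int) \<Rightarrow> nat \<Rightarrow> int" where
  "restrict0 J x = (\<lambda>i. if i \<in> J then x i else 0)"

text \<open>\<open>H\<close> lifts \<open>F\<close> to the integers as a function of the coordinates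
  in \<open>J\<close>, the others being frozen at 0. Congruent tuples are joined by an arc, so both
  conditions together make \<open>H\<close> depend on residues only.\<close>

definition lift_on :: "nat set \<Rightarrow> ((nat \<Rightarrow> int) \<Rightarrow> int) \<Rightarrow> bool" where
  "lift_on J H \<longleftrightarrow> (\<forall>x. [H x = F (restrict0 J x)] (mod n)) \<and>
     (\<forall>x y. (\<forall>i\<in>J. R (x i) (y i)) \<longrightarrow> \<bar>H x - H y\<bar> \<le> 1)"

text \<open>The displacement over one turn is a multiple of \<open>n\<close> of size at most
  \<open>n\<close>. If it were \<open>n\<close> or \<open>- n\<close>, all steps would be equal and
  coordinate \<open>j\<close> would wind; so it is 0 and the lift closes up.\<close>

lemma lift_path:
  assumes "\<not> winds j x 1" "\<not> winds j x (- 1)" "[h = F (x(j := 0))] (mod n)"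
  shows "\<exists>L. L 0 = h \<and> (\<forall>t. [L t = F (x(j := t))] (mod n)) \<and> (\<forall>t. \<bar>L (t + 1) - L t\<bar> \<le> (1::int)) \<and>
    (\<forall>s t. [s = t] (mod n) \<longrightarrow> L s = L t)"
proof -
  define \<phi> where "\<phi> = (\<lambda>t. F (x(j := t)))"
  have \<phi>_cong: "[\<phi> s = \<phi> t] (mod n)" if "[s = t] (mod n)" for s t
    unfolding \<phi>_def using that by (intro F_cong) auto
  have \<phi>_hom: "R (\<phi> s) (\<phi> t)" if "R s t" for s t
    unfolding \<phi>_def using that by (intro F_hom) (auto simp: R_refl)
  have "\<exists>d. \<bar>d\<bar> \<le> 1 \<and> [\<phi> (t + 1) = \<phi> t + d] (mod n)" for t
  proof (cases "R t (t + 1)")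
    case True
    with R_near[OF \<phi>_hom] show ?thesis
      by blast
  next
    case False
    interpret dual: star_cycle n "R\<inverse>\<inverse>"
      by (rule star_cycle_conversep)
    from False R_edge[of t] have "R\<inverse>\<inverse> (\<phi> t) (\<phi> (t + 1))"
      using \<phi>_hom by auto
    with dual.R_near show ?thesis
      by blast
  qed
  then obtain d where d: "\<And>t. \<bar>d t\<bar> \<le> 1" "\<And>t. [\<phi> (t + 1) = \<phi> t + d t] (mod n)"
    by metis
  define S where "S m = h + (\<Sum>k<m. d (int k))" for m
  have S: "[S m = \<phi> (int m)] (mod n)" for m
  proof (induction m)
    case 0
    with assms(3) show ?case
      by (simp add: S_def \<phi>_def)
  next
    case (Suc m)
    have "[S m + d (int m) = \<phi> (int m) + d (int m)] (mod n)"
      using Suc by (intro cong_add cong_refl)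
    also have "[\<phi> (int m) + d (int m) = \<phi> (int m + 1)] (mod n)"
      using d(2) by (rule cong_sym)
    finally show ?case
      by (simp add: S_def add.commute add.left_commute)
  qed
  define N where "N = nat n"
  have N: "int N = n"
    using n_ge_4 by (simp add: N_def)
  have not_all: "\<not> (\<forall>k<N. d (int k) = e)" if "e = 1 \<or> e = - 1" for e
  proof
    assume *: "\<forall>k<N. d (int k) = e"
    have "winds j x e"
      unfolding winds_def
    proof
      fix t
      define k where "k = nat (t mod n)"
      have k: "k < N" "[int k = t] (mod n)"
        using n_ge_4 by (auto simp: k_def N_def cong_def nat_less_iff)
      have "[\<phi> (t + 1) = \<phi> (int k + 1)] (mod n)"
        using k(2) by (intro \<phi>_cong cong_add cong_sym[OF k(2)] cong_refl)
      also have "[\<phi> (int k + 1) = \<phi> (int k) + e] (mod n)"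
        using d(2)[of "int k"] * k(1) by simp
      also have "[\<phi> (int k) + e = \<phi> t + e] (mod n)"
        using k(2) by (intro \<phi>_cong cong_add cong_refl)
      finally show "[F (x(j := t + 1)) = F (x(j := t)) + e] (mod n)"
        by (simp add: \<phi>_def)
    qed
    with that assms show False
      by auto
  qed
  have "S N = h"
  proof -
    let ?D = "\<Sum>k<N. d (int k)"
    have "[S N = \<phi> (int N)] (mod n)"
      by (rule S)
    also have "[\<phi> (int N) = \<phi> 0] (mod n)"
      by (intro \<phi>_cong) (simp add: N cong_def)
    also have "[\<phi> 0 = h] (mod n)"
      using assms(3) by (simp add: \<phi>_def cong_sym)
    finally have dvd: "n dvd ?D"
      by (simp add: S_def cong_iff_dvd_diff)
    have "?D \<noteq> n"
    proof
      assume "?D = n"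
      then have "(\<Sum>k<N. 1 - d (int k)) = 0"
        by (simp add: sum_subtractf N)
      then have "\<forall>k<N. d (int k) = 1"
        using d(1) by (subst (asm) sum_nonneg_eq_0_iff) (auto simp: abs_le_iff)
      with not_all[of 1] show False
        by simp
    qed
    moreover have "?D \<noteq> - n"
    proof
      assume "?D = - n"
      then have "(\<Sum>k<N. d (int k) + 1) = 0"
        by (simp add: sum.distrib N)
      moreover have "0 \<le> d (int k) + 1" for k
        using d(1)[of "int k"] by linarith
      ultimately have "\<forall>k<N. d (int k) + 1 = 0"
        by (subst (asm) sum_nonneg_eq_0_iff) auto
      then have "\<forall>k<N. d (int k) = - 1"
        by (simp add: eq_neg_iff_add_eq_0)
      with not_all[of "- 1"] show False
        by simp
    qed
    moreover have "\<bar>?D\<bar> \<le> n"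
      using order_trans[OF sum_abs sum_bounded_above[of "{..<N}" "\<lambda>k. \<bar>d (int k)\<bar>" 1]] d(1) N
      by simp
    ultimately have "\<bar>?D\<bar> < n"
      by linarith
    with dvd have "?D = 0"
      using cong_small_eq[of ?D 0] by (simp add: cong_iff_dvd_diff)
    then show ?thesis
      by (simp add: S_def)
  qed
  \<comment> \<open>The lift over one turn is repeated periodically; \<open>S N = h\<close> makes it
    fit at the seam.\<close>
  define L where "L t = S (nat (t mod n))" for t
  have "L 0 = h"
    by (simp add: L_def S_def)
  moreover have "[L t = F (x(j := t))] (mod n)" for t
  proof -
    have "[L t = \<phi> (t mod n)] (mod n)"
      using S[of "nat (t mod n)"] n_ge_4 by (simp add: L_def)
    also have "[\<phi> (t mod n) = \<phi> t] (mod n)"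
      by (intro \<phi>_cong) (simp add: cong_def)
    finally show ?thesis
      by (simp add: \<phi>_def)
  qed
  moreover have "\<bar>L (t + 1) - L t\<bar> \<le> 1" for t
  proof -
    define k where "k = nat (t mod n)"
    have k: "int k = t mod n" "k < N"
      using n_ge_4 by (auto simp: k_def N_def nat_less_iff)
    have "L (t + 1) = S (Suc k)"
    proof (cases "Suc k = N")
      case True
      then have "(t + 1) mod n = 0"
        using k(1) N by (metis mod_add_left_eq mod_self of_nat_Suc add.commute)
      with True \<open>S N = h\<close> \<open>L 0 = h\<close> show ?thesis
        by (simp add: L_def)
    next
      case False
      with k(2) have "int (Suc k) < n"
        using N by linarith
      then have "(t + 1) mod n = int (Suc k)"
        using k(1) by (metis mod_add_left_eq mod_pos_pos_trivial of_nat_0_le_iff of_nat_Suc add.commute)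
      then show ?thesis
        by (simp only: L_def nat_int)
    qed
    moreover have "L t = S k"
      by (simp add: L_def k_def)
    ultimately show ?thesis
      using d(1)[of "int k"] by (simp add: S_def)
  qed
  moreover have "L s = L t" if "[s = t] (mod n)" for s t
    using that by (simp add: L_def cong_def)
  ultimately show ?thesis
    by blast
qed

text \<open>Each line in direction \<open>j\<close> is lifted from the starting value
  \<open>H x\<close>. The point is that lifts over neighbouring lines stay within 1 of each
  other.\<close>

lemma lift_insert:
  assumes H: "lift_on J H" and j: "j \<in> I" "j \<notin> J" and "J \<subseteq> I"
    and nw: "\<And>x. \<not> winds j x 1" "\<And>x. \<not> winds j x (- 1)"
  shows "\<exists>H. lift_on (insert j J) H"
proof -
  have "\<exists>L. L 0 = H x \<and> (\<forall>t. [L t = F ((restrict0 J x)(j := t))] (mod n)) \<and>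
      (\<forall>t. \<bar>L (t + 1) - L t\<bar> \<le> (1::int)) \<and> (\<forall>s t. [s = t] (mod n) \<longrightarrow> L s = L t)" for x
  proof (rule lift_path[OF nw])
    have "(restrict0 J x)(j := 0) = restrict0 J x"
      using j(2) by (auto simp: restrict0_def)
    with H show "[H x = F ((restrict0 J x)(j := 0))] (mod n)"
      by (simp add: lift_on_def)
  qed
  then obtain L where L0: "\<And>x. L x 0 = H x"
    and L_F: "\<And>x t. [L x t = F ((restrict0 J x)(j := t))] (mod n)"
    and L_step: "\<And>x t. \<bar>L x (t + 1) - L x t\<bar> \<le> (1::int)"
    and L_cong: "\<And>x s t. [s = t] (mod n) \<Longrightarrow> L x s = L x t"
    by metis
  have L_R: "R (L x s) (L y t)" if "\<forall>i\<in>J. R (x i) (y i)" "R s t" for x y s t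
  proof -
    have "R (F ((restrict0 J x)(j := s))) (F ((restrict0 J y)(j := t)))"
      using that by (intro F_hom) (auto simp: restrict0_def R_refl)
    then show ?thesis
      by (rule R_cong[OF cong_sym[OF L_F] cong_sym[OF L_F]])
  qed
  have same: "\<bar>L x (int m) - L y (int m)\<bar> \<le> 1" if xy: "\<forall>i\<in>J. R (x i) (y i)" for x y m
  proof (induction m)
    case 0
    with H xy show ?case
      by (simp add: L0 lift_on_def)
  next
    case (Suc m)
    let ?t = "int m"
    have x: "\<bar>L x (?t + 1) - L x ?t\<bar> \<le> 1" and y: "\<bar>L y (?t + 1) - L y ?t\<bar> \<le> 1"
      by (rule L_step)+
    \<comment> \<open>Going along both lines would only bound this by 3. A diagonal joined by an arc
      has length at most 2, hence at most 1 by \<open>R_close\<close>.\<close>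
    from R_edge[of ?t] have "\<bar>L x (?t + 1) - L y (?t + 1)\<bar> \<le> 2"
    proof
      assume "R ?t (?t + 1)"
      with R_close[OF L_R[OF xy this]] Suc x y show ?thesis
        by linarith
    next
      assume "R (?t + 1) ?t"
      with R_close[OF L_R[OF xy this]] Suc x y show ?thesis
        by linarith
    qed
    with R_close[OF L_R[OF xy R_refl]] show ?case
      by (simp add: add.commute)
  qed
  have "lift_on (insert j J) (\<lambda>x. L x (x j))"
    unfolding lift_on_def
  proof (intro conjI allI impI)
    fix x
    have "(restrict0 J x)(j := x j) = restrict0 (insert j J) x"
      by (auto simp: restrict0_def)
    with L_F[of x "x j"] show "[L x (x j) = F (restrict0 (insert j J) x)] (mod n)"
      by simp
  next
    fix x y
    assume xy: "\<forall>i\<in>insert j J. R (x i) (y i)"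
    then have R: "R (L x (x j)) (L y (y j))"
      by (intro L_R) auto
    define k where "k = nat (x j mod n)"
    have "[int k = x j] (mod n)"
      using n_ge_4 by (simp add: k_def cong_def)
    then have "\<bar>L x (x j) - L y (x j)\<bar> \<le> 1"
      using same[of x y k] xy L_cong[of "int k" "x j"] by auto
    moreover have "\<bar>L y (x j) - L y (y j)\<bar> \<le> 1"
    proof -
      obtain d where d: "\<bar>d\<bar> \<le> 1" "[y j = x j + d] (mod n)"
        using R_near xy by blast
      have "\<bar>L y (x j) - L y (x j + d)\<bar> \<le> 1"
      proof -
        consider "d = 0" | "d = 1" | "d = - 1"
          using d(1) by linarith
        then show ?thesis
          using L_step[of y "x j"] L_step[of y "x j - 1"] by cases auto
      qed
      with L_cong[OF d(2)] show ?thesis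
        by simp
    qed
    ultimately show "\<bar>L x (x j) - L y (y j)\<bar> \<le> 1"
      by (intro R_close[OF R]) linarith
  qed
  then show ?thesis
    by blast
qed

lemma lift_exists:
  assumes "\<And>j x. j \<in> I \<Longrightarrow> \<not> winds j x 1" "\<And>j x. j \<in> I \<Longrightarrow> \<not> winds j x (- 1)"
  shows "\<exists>H. lift_on I H"
proof -
  have "J \<subseteq> I \<longrightarrow> (\<exists>H. lift_on J H)" if "finite J" for J
    using that
  proof (induction J)
    case empty
    have "lift_on {} (\<lambda>x. F (\<lambda>i. 0))"
      by (simp add: lift_on_def restrict0_def)
    then show ?case
      by blast
  next
    case (insert j J)
    show ?case
    proof
      assume "insert j J \<subseteq> I"
      with insert obtain H where "lift_on J H"
        by auto
      with \<open>insert j J \<subseteq> I\<close> insert(2) show "\<exists>H. lift_on (insert j J) H"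
        by (intro lift_insert[of J H j] assms) auto
    qed
  qed
  from this[OF finite_I] show ?thesis
    by simp
qed

section \<open>Liftable polymorphisms are not onto\<close>

lemma not_lift_surj:
  assumes H: "lift_on I H" and surj: "\<And>v. \<exists>x. [F x = v] (mod n)"
  shows False
proof -
  have H_F: "[H x = F x] (mod n)" for x
    using H cong_trans[OF _ F_cong[of "restrict0 I x" x]] by (auto simp: lift_on_def restrict0_def)
  have H_eq: "H x = H y" if "\<And>i. [x i = y i] (mod n)" for x y
  proof (rule cong_small_eq)
    show "[H x = H y] (mod n)"
      using cong_trans[OF H_F cong_trans[OF F_cong cong_sym[OF H_F]]] that by blast
    have "\<bar>H x - H y\<bar> \<le> 1"
      using H R_all_cong[OF that] by (simp add: lift_on_def)
    with n_ge_4 show "\<bar>H x - H y\<bar> < n"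
      by linarith
  qed
  define E where "E a b \<longleftrightarrow> R a b \<and> \<bar>a - b\<bar> \<le> 1" for a b
  have E_near: "\<bar>a - b\<bar> \<le> 1" if "E a b" for a b
    using that by (simp add: E_def)
  have E_refl: "reflp E" and R_reflp: "reflp R"
    by (auto simp: reflp_def E_def R_refl)
  have H_E: "E (H x) (H y)" if "\<forall>i. R (x i) (y i)" for x y
  proof -
    have "R (H x) (H y)"
      using that by (intro R_cong[OF cong_sym[OF H_F] cong_sym[OF H_F] F_hom]) auto
    with H that show ?thesis
      by (simp add: E_def lift_on_def)
  qed

  \<comment> \<open>Preimages of the \<open>n\<close> residues have lifts with distinct residues,
    and \<open>n\<close> distinct integers span at least \<open>n - 1\<close>.\<close>
  obtain x y where xy: "H x + n - 1 \<le> H y"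
  proof -
    obtain X where X: "\<And>v. [F (X v) = v] (mod n)"
      using surj by metis
    define h where "h v = H (X v)" for v
    have h: "[h v = v] (mod n)" for v
      unfolding h_def using cong_trans[OF H_F X] .
    have "inj_on h {0..<n}"
    proof (rule inj_onI)
      fix u v assume uv: "u \<in> {0..<n}" "v \<in> {0..<n}" "h u = h v"
      then have "[u = v] (mod n)"
        using cong_trans[OF cong_sym[OF h[of u]]] h[of v] by simp
      with uv show "u = v"
        by (intro cong_small_eq) auto
    qed
    then have card: "card (h ` {0..<n}) = nat n"
      by (simp add: card_image)
    let ?S = "h ` {0..<n}"
    have S: "finite ?S" "?S \<noteq> {}"
      using n_ge_4 by auto
    have "card ?S \<le> card {Min ?S..Max ?S}"
      using S by (intro card_mono) auto
    then have "n \<le> Max ?S - Min ?S + 1"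
      using card n_ge_4 by simp
    moreover obtain u v where "Min ?S = h u" "Max ?S = h v"
      using Min_in[OF S] Max_in[OF S] by blast
    ultimately show ?thesis
      using that[of "X u" "X v"] by (simp add: h_def)
  qed
  define a b where "a = H x" and "b = H x + n - 1"

  \<comment> \<open>Two steps per edge suffice, so the least length \<open>l\<close> below
    exists.\<close>
  have "zigzag_both (2 * m) E c (c + int m)" for m c
  proof (induction m arbitrary: c)
    case 0
    then show ?case
      by (simp add: zigzag_both_def)
  next
    case (Suc m)
    have "zigzag_both 2 E c (c + 1)"
      using R_edge[of c] by (intro zigzag_both_2 E_refl) (auto simp: E_def)
    from zigzag_both_trans[OF this Suc[of "c + 1"]] show ?case
      by (simp add: add.assoc)
  qed
  moreover have "a + int (nat (n - 1)) = b"
    using n_ge_4 by (simp add: a_def b_def)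
  ultimately have ex: "zigzag_both (2 * nat (n - 1)) E a b"
    by metis
  define l where "l = (LEAST l. zigzag_both l E a b)"
  have l: "zigzag_both l E a b" "\<And>m. zigzag_both m E a b \<Longrightarrow> l \<le> m"
    using LeastI[where P = "\<lambda>l. zigzag_both l E a b", OF ex] Least_le[where P = "\<lambda>l. zigzag_both l E a b"]
    by (simp_all only: l_def)
  have "\<bar>a - b\<bar> \<le> int l"
    using l(1) zigzag_length[of E l a b] E_near by (auto simp: zigzag_both_def)
  \<comment> \<open>This leaves \<open>m\<close> at least 2, room for the two-step walk across the
    closing edge.\<close>
  then have "3 \<le> l"
    using n_ge_4 by (simp add: a_def b_def)
  then obtain m where m: "l = Suc m" "2 \<le> m"
    by (cases l) auto

  have E_truncate: "zigzag_both k E u v" if "zigzag_both (Suc k) E u w" "u \<le> v" "v < w" for k u v w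
    using zigzag_both_truncate[of E k u w v] E_near E_refl that by blast
  have E_truncate_left: "zigzag_both k E v w" if "zigzag_both (Suc k) E u w" "u < v" "v \<le> w" for k u v w
    using zigzag_both_truncate_left[of E k u w v] E_near E_refl that by blast
  have E_shorten: "zigzag_both k E u v" if "zigzag_both k E u w" "u \<le> v" "v \<le> w" for k u v w
  proof (cases "v = w")
    case False
    with that obtain k' where "k = Suc k'"
      by (cases k) (auto simp: zigzag_both_def)
    with False that E_truncate[of k' u w v] zigzag_both_Suc[OF E_refl] show ?thesis
      by auto
  qed (use that in simp)
  have E_shorten_left: "zigzag_both k E v w" if "zigzag_both k E u w" "u \<le> v" "v \<le> w" for k u v w
  proof (cases "v = u")
    case False
    with that obtain k' where "k = Suc k'"
      by (cases k) (auto simp: zigzag_both_def)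
    with False that E_truncate_left[of k' u w v] zigzag_both_Suc[OF E_refl] show ?thesis
      by auto
  qed (use that in simp)
  have E_imp_R: "zigzag_both k R u v" if "zigzag_both k E u v" for k u v
    by (rule zigzag_both_hom[where r = E and s = R and h = "\<lambda>x. x", OF _ that]) (simp add: E_def)

  have inside: "zigzag_both m R u v" if uv: "a \<le> u" "u \<le> v" "v \<le> b" for u v
  proof -
    consider "u = a" "v = b" | "a < u" | "v < b"
      using uv by linarith
    then show ?thesis
    proof cases
      case 1
      \<comment> \<open>The closing edge of the cycle joins \<open>a\<close> to
        \<open>a - 1\<close>, which is \<open>b\<close> modulo \<open>n\<close>.\<close>
      have "[a - 1 = b] (mod n)"
        by (simp add: a_def b_def cong_iff_dvd_diff)
      with R_edge[of "a - 1"] R_cong[of a a "a - 1" b] R_cong[of "a - 1" b a a] have "R a b \<or> R b a"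
        by auto
      with 1 have "zigzag_both 2 R u v"
        by (intro zigzag_both_2 R_reflp) auto
      with m(2) show ?thesis
        using zigzag_both_mono[OF R_reflp] by blast
    next
      case 2
      then have "zigzag_both m E u b"
        using l(1) uv by (intro E_truncate_left[of m a b u]) (simp_all add: m(1))
      then have "zigzag_both m E u v"
        by (rule E_shorten) (use uv in auto)
      then show ?thesis
        by (rule E_imp_R)
    next
      case 3
      then have "zigzag_both m E a v"
        using l(1) uv by (intro E_truncate[of m a b v]) (simp_all add: m(1))
      then have "zigzag_both m E u v"
        by (rule E_shorten_left) (use uv in auto)
      then show ?thesis
        by (rule E_imp_R)
    qed
  qed

  \<comment> \<open>Every coordinate is moved into the window from \<open>a\<close> to
    \<open>b\<close>, where \<open>inside\<close> applies; \<open>H\<close> keeps its value.\<close>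
  define norm where "norm z = (\<lambda>i :: nat. a + (z i - a) mod n)" for z
  have norm_cong: "[norm z i = z i] (mod n)" for z i
    by (simp add: norm_def cong_def mod_simps)
  have norm_range: "a \<le> norm z i" "norm z i \<le> b" for z i
    using n_ge_4 pos_mod_bound[of n "z i - a"] by (auto simp: norm_def a_def b_def)
  have "zigzag_both m R (norm x i) (norm y i)" for i
    using inside[of "norm x i" "norm y i"] inside[of "norm y i" "norm x i"] norm_range zigzag_both_sym
    by (meson linear)
  then have "zigzag_both m (\<lambda>x y. \<forall>i. R (x i) (y i)) (norm x) (norm y)"
    by (rule zigzag_both_power)
  then have "zigzag_both m E (H (norm x)) (H (norm y))"
    using zigzag_both_hom[of "\<lambda>x y. \<forall>i. R (x i) (y i)" E H m "norm x" "norm y"] H_E by blast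
  moreover have "H (norm x) = a" "H (norm y) = H y"
    using H_eq[OF norm_cong] by (auto simp: a_def)
  ultimately have *: "zigzag_both m E a (H y)"
    by simp
  \<comment> \<open>\<open>b\<close> lies between \<open>a\<close> and \<open>H y\<close>, so walks
    of length \<open>m = l - 1\<close> reach it as well, against the choice of
    \<open>l\<close>.\<close>
  have "zigzag_both m E a b"
    by (rule E_shorten[OF *]) (use xy n_ge_4 in \<open>auto simp: a_def b_def\<close>)
  with l(2) m(1) show False
    by fastforce
qed

lemma surj_polymorphism_unary:
  assumes "\<And>v. \<exists>x. [F x = v] (mod n)"
  shows "\<exists>j\<in>I. \<forall>x y. x j = y j \<longrightarrow> [F x = F y] (mod n)"
proof -
  obtain j z e where j: "j \<in> I" "winds j z e" "e = 1 \<or> e = - 1"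
    using lift_exists not_lift_surj[OF _ assms] by blast
  have "[F x = F y] (mod n)" if "x j = y j" for x y
    using winds_unary[OF j(2,3,1), of x] winds_unary[OF j(2,3,1), of y] that
    by (metis cong_sym cong_trans)
  with j(1) show ?thesis
    by blast
qed

end


section \<open>Cycle digraphs\<close>

text \<open>The definition numbers the edges from 1; here the letter \<open>W ! u\<close> belongs to
  the edge from \<open>u\<close> to its cyclic successor.\<close>

lemma parcs_cycle_digraph:
  "(u, v) \<in> parcs (cycle_digraph W) \<longleftrightarrow> u < length W \<and> v < length W \<and>
     (u = v \<or> (v = Suc u mod length W \<and> W ! u \<in> {Plus, Star}) \<or>
      (u = Suc v mod length W \<and> W ! v \<in> {Minus, Star}))"
  (is "?L \<longleftrightarrow> ?R")
proof
  assume ?L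
  then show ?R
    by (auto simp: cycle_digraph_def Let_def intro!: mod_less_divisor)
next
  assume R: ?R
  have "(u, v) \<in> parcs (cycle_digraph W)" if "v = Suc u mod length W" "W ! u \<in> {Plus, Star}"
    using that R unfolding cycle_digraph_def Let_def
    by (auto intro!: exI[of _ "Suc u"])
  moreover have "(u, v) \<in> parcs (cycle_digraph W)" if "u = Suc v mod length W" "W ! v \<in> {Minus, Star}"
    using that R unfolding cycle_digraph_def Let_def
    by (auto intro!: exI[of _ "Suc v"])
  moreover have "(u, v) \<in> parcs (cycle_digraph W)" if "u = v"
    using that R by (auto simp: cycle_digraph_def Let_def)
  ultimately show ?L
    using R by blast
qed

lemma pverts_cycle_digraph: "pverts (cycle_digraph W) = {0..<length W}"
  by (simp add: cycle_digraph_def Let_def)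

lemma star_cycle_cycle_digraph:
  assumes "4 \<le> length W" "Star \<in> set W"
  defines "n \<equiv> int (length W)"
  shows "star_cycle n (\<lambda>a b. (nat (a mod n), nat (b mod n)) \<in> parcs (cycle_digraph W))"
proof
  let ?R = "\<lambda>a b. (nat (a mod n), nat (b mod n)) \<in> parcs (cycle_digraph W)"
  have n: "0 < n"
    unfolding n_def using assms(1) by linarith
  have lt: "nat (a mod n) < length W" for a
    using n by (simp add: n_def nat_less_iff)
  have Suc: "Suc (nat (a mod n)) mod length W = nat ((a + 1) mod n)" for a
  proof -
    have "int (Suc (nat (a mod n)) mod length W) = (a mod n + 1) mod n"
      using n by (simp add: n_def zmod_int add.commute)
    also have "\<dots> = (a + 1) mod n"
      by (simp add: mod_simps)
    finally show ?thesis
      by (metis nat_int)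
  qed
  have nat_mod_eq: "[a = b] (mod n)" if "nat (a mod n) = nat (b mod n)" for a b
    using that n by (simp add: cong_def eq_nat_nat_iff)
  show "4 \<le> n"
    using assms(1) by (simp add: n_def)
  show "?R a' b'" if "[a = a'] (mod n)" "[b = b'] (mod n)" "?R a b" for a a' b b'
    using that by (simp add: cong_def)
  show "?R a a" for a
    using lt by (simp add: parcs_cycle_digraph)
  show "\<exists>d. \<bar>d\<bar> \<le> 1 \<and> [b = a + d] (mod n)" if ab: "?R a b" for a b
  proof -
    consider "nat (a mod n) = nat (b mod n)" | "nat (b mod n) = nat ((a + 1) mod n)"
      | "nat (a mod n) = nat ((b + 1) mod n)"
      using ab by (auto simp: parcs_cycle_digraph Suc)
    then show ?thesis
    proof cases
      case 1
      then show ?thesis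
        by (intro exI[of _ 0]) (auto dest: nat_mod_eq cong_sym)
    next
      case 2
      then show ?thesis
        by (intro exI[of _ 1]) (auto dest: nat_mod_eq)
    next
      case 3
      then have "[b = a + (- 1)] (mod n)"
        using cong_add[OF cong_sym[OF nat_mod_eq[OF 3]] cong_refl[of "- 1"]] by simp
      then show ?thesis
        by (intro exI[of _ "- 1"]) simp
    qed
  qed
  show "?R a (a + 1) \<or> ?R (a + 1) a" for a
    by (cases "W ! nat (a mod n)") (simp_all add: parcs_cycle_digraph Suc lt)
  obtain s where s: "s < length W" "W ! s = Star"
    using assms(2) by (auto simp: in_set_conv_nth)
  then have "nat (int s mod n) = s"
    by (simp add: n_def)
  with s Suc[of "int s"] show "\<exists>s. ?R s (s + 1) \<and> ?R (s + 1) s"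
    by (intro exI[of _ "int s"]) (auto simp: parcs_cycle_digraph lt)
qed

lemma cycle_digraph_slupecki:
  assumes "4 \<le> length W" "Star \<in> set W"
  shows "slupecki (cycle_digraph W)"
  unfolding slupecki_def
proof (intro allI impI, elim conjE)
  fix k f
  assume k: "1 \<le> k" and f: "polymorphism (cycle_digraph W) k f"
    and surj: "f ` pverts (digraph_power (cycle_digraph W) k) = pverts (cycle_digraph W)"
  let ?G = "cycle_digraph W"
  let ?V = "{0..<length W}"
  let ?T = "{1..k} \<rightarrow>\<^sub>E ?V"
  define n where "n = int (length W)"
  define R where "R a b \<longleftrightarrow> (nat (a mod n), nat (b mod n)) \<in> parcs ?G" for a b
  \<comment> \<open>\<open>tup\<close> turns an integer function into a tuple of vertices, so that
    \<open>f\<close> becomes a map \<open>F\<close> to which the locale applies.\<close>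
  define tup where "tup x = restrict (\<lambda>i. nat (x i mod n)) {1..k}" for x :: "nat \<Rightarrow> int"
  define F where "F x = int (f (tup x))" for x
  have T: "pverts (digraph_power ?G k) = ?T"
    by (simp add: digraph_power_def pverts_cycle_digraph)
  have f_range: "f x \<in> ?V" if "x \<in> ?T" for x
    using f that by (auto simp: polymorphism_def digraph_hom_def T pverts_cycle_digraph)
  have f_arc: "(f x, f y) \<in> parcs ?G"
    if "x \<in> ?T" "y \<in> ?T" "\<And>i. i \<in> {1..k} \<Longrightarrow> (x i, y i) \<in> parcs ?G" for x y
  proof -
    have "(x, y) \<in> parcs (digraph_power ?G k)"
      using that by (simp add: digraph_power_def pverts_cycle_digraph)
    with f show ?thesis
      by (auto simp: polymorphism_def digraph_hom_def)
  qed
  have n: "0 < n"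
    unfolding n_def using assms(1) by linarith
  have tup_T: "tup x \<in> ?T" for x
    using n by (auto simp: tup_def n_def nat_less_iff)
  have tup_int: "tup (\<lambda>i. int (x i)) = x" if "x \<in> ?T" for x
    using that by (auto simp: tup_def n_def fun_eq_iff PiE_def extensional_def Pi_def)
  have F_mod: "nat (F x mod n) = f (tup x)" for x
    using f_range[OF tup_T, of x] by (simp add: F_def n_def)
  interpret star_cycle n R
    unfolding R_def n_def by (rule star_cycle_cycle_digraph) (use assms in auto)
  interpret star_cycle_polymorphism n R "{1..k}" F
  proof
    show "R (F x) (F y)" if "\<And>i. i \<in> {1..k} \<Longrightarrow> R (x i) (y i)" for x y
      unfolding R_def F_mod using that by (intro f_arc tup_T) (simp add: tup_def R_def)
    show "[F x = F y] (mod n)" if "\<And>i. i \<in> {1..k} \<Longrightarrow> [x i = y i] (mod n)" for x y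
    proof -
      have "tup x = tup y"
        unfolding tup_def using that by (intro restrict_ext) (simp add: cong_def)
      then show ?thesis
        by (simp add: F_def)
    qed
  qed simp
  have "\<exists>x. [F x = v] (mod n)" for v
  proof -
    have "nat (v mod n) \<in> f ` ?T"
      using surj n by (simp add: T pverts_cycle_digraph n_def nat_less_iff)
    then obtain x where x: "x \<in> ?T" "f x = nat (v mod n)"
      by auto
    then have "F (\<lambda>i. int (x i)) = v mod n"
      using n by (simp add: F_def tup_int)
    then show ?thesis
      by (intro exI[of _ "\<lambda>i. int (x i)"]) (simp add: cong_def)
  qed
  then obtain j where j: "j \<in> {1..k}" "\<And>x y. x j = y j \<Longrightarrow> [F x = F y] (mod n)"
    using surj_polymorphism_unary by blast
  have unary: "f x = f y" if "x \<in> ?T" "y \<in> ?T" "x j = y j" for x y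
    using j(2)[of "\<lambda>i. int (x i)" "\<lambda>i. int (y i)"] that F_mod[of "\<lambda>i. int (x i)"]
      F_mod[of "\<lambda>i. int (y i)"] by (simp add: tup_int cong_def)
  \<comment> \<open>The constant tuple with value \<open>x j\<close> agrees with \<open>x\<close> in
    coordinate \<open>j\<close>, so \<open>f\<close> takes the same value on both.\<close>
  define g where "g v = f (restrict (\<lambda>_. v) {1..k})" for v
  have const: "restrict (\<lambda>_. v) {1..k} \<in> ?T" if "v \<in> ?V" for v
    using that by auto
  have "digraph_hom ?G ?G g"
  proof -
    have "g \<in> pverts ?G \<rightarrow> pverts ?G"
      unfolding pverts_cycle_digraph g_def using f_range const by blast
    moreover have "(g u, g v) \<in> parcs ?G" if "(u, v) \<in> parcs ?G" for u v
    proof -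
      have "u \<in> ?V" "v \<in> ?V"
        using that by (auto simp: parcs_cycle_digraph)
      with that show ?thesis
        unfolding g_def by (intro f_arc const) auto
    qed
    ultimately show ?thesis
      by (auto simp: digraph_hom_def)
  qed
  moreover have "f x = g (x j)" if "x \<in> ?T" for x
    unfolding g_def using that j(1) by (intro unary const) auto
  ultimately show "essentially_unary ?G k f"
    unfolding essentially_unary_def T using j(1) by blast
qed

text \<open>The appended letter brings the length to at least 4, and \<open>P\<close> contributes a
  two-way edge.\<close>

theorem theorem5p4:
  fixes P :: "letter list"
  assumes "self_dual P"
    and "length P \<ge> 3"
    and "count_list P Star \<ge> 2"
  shows "slupecki (cycle_digraph (P @ [Plus]))"
proof (rule cycle_digraph_slupecki)
  show "Star \<in> set (P @ [Plus])"
    using assms(3) count_notin[of Star P] by fastforce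
qed (use assms(2) in simp)

end
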